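(* If $m\ge 3$ and $n\ge 3$, then $\chi_{\rho}(K_{1,m}, K_{1,n})=3$ and $$\min\{m+2,n+2\}\le \widehat{\chi}_{\rho}(K_{1,m}, K_{1,n})\le \max\{m+2,n+2\}\,.$$
   Context: For graphs $G$ and $H$ and a function $f\colon V(G)\to V(H)$, the Sierpiński product $G\otimes_f H$ is the graph with vertex set $V(G)\times V(H)$ whose edges are: $(g,h)(g,h')$ for every $g\in V(G)$ and every edge $hh'\in E(H)$; and $(g,f(g'))(g',f(g))$ for every edge $gg'\in E(G)$. Let $H^G$ denote the set of all functions $V(G)\to V(H)$. For a graph $X$, a packing $k$-coloring is a map $c\colon V(X)\to\{1,\dots,k\}$ such that whenever $u\neq v$ and $c(u)=c(v)=\ell$, the shortest-path distance satisfies $d_X(u,v)>\ell$; the packing chromatic number $\chi_\rho(X)$ is the least $k$ for which a packing $k$-coloring exists. The Sierpiński packing chromatic number of $(G,H)$ is $\chi_\rho(G,H)=\min_{f\in H^G}\chi_\rho(G\otimes_f H)$ and the upper one is $\widehat{\chi}_\rho(G,H)=\max_{f\in H^G}\chi_\rho(G\otimes_f H)$. $K_{1,m}$ is the star with $m$ leaves. *)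

theory Defs
  imports "Graph_Theory.Graph_Theory" "HOL-Library.FuncSet"
begin

text \<open>
  A finite simple graph is a \<^typ>\<open>'a pair_pre_digraph\<close> satisfying \<^locale>\<open>pair_graph\<close>:
  the undirected edge \<open>uv\<close> is the pair of opposite arcs \<open>(u, v)\<close> and \<open>(v, u)\<close>.
\<close>

definition sierpinski_product ::
  "'a pair_pre_digraph \<Rightarrow> ('a \<Rightarrow> 'b) \<Rightarrow> 'b pair_pre_digraph \<Rightarrow> ('a \<times> 'b) pair_pre_digraph" where
  "sierpinski_product G f H =
     \<lparr> pverts = pverts G \<times> pverts H,
       parcs = {((g, h), (g, h')) | g h h'. g \<in> pverts G \<and> (h, h') \<in> parcs H}
             \<union> {((g, f g'), (g', f g)) | g g'. (g, g') \<in> parcs G} \<rparr>"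

lemma pair_graph_iff:
  "pair_graph G \<longleftrightarrow> finite (pverts G) \<and> parcs G \<subseteq> pverts G \<times> pverts G \<and>
     sym (parcs G) \<and> (\<forall>v. (v, v) \<notin> parcs G)"
  unfolding pair_graph_def pair_digraph_def pair_pseudo_graph_def pair_fin_digraph_def
    pair_sym_digraph_def pair_loopfree_digraph_def pair_wf_digraph_def pair_fin_digraph_axioms_def
    pair_sym_digraph_axioms_def pair_loopfree_digraph_axioms_def symmetric_def with_proj_simps
  by (auto intro: finite_subset[of "parcs G" "pverts G \<times> pverts G"])

lemma pair_graph_sierpinski_product:
  assumes "pair_graph G" "pair_graph H" "f \<in> pverts G \<rightarrow> pverts H"
  shows "pair_graph (sierpinski_product G f H)"
  using assms unfolding pair_graph_iff sierpinski_product_def sym_def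
  by fastforce

text \<open>The shortest-path distance, \<open>\<infinity>\<close> between different components.\<close>

definition graph_dist :: "'a pair_pre_digraph \<Rightarrow> 'a \<Rightarrow> 'a \<Rightarrow> ereal" where
  "graph_dist X u v = wf_digraph.\<mu> (with_proj X) (\<lambda>_. 1) u v"

definition packing_coloring :: "'a pair_pre_digraph \<Rightarrow> nat \<Rightarrow> ('a \<Rightarrow> nat) \<Rightarrow> bool" where
  "packing_coloring X k c \<longleftrightarrow>
     c \<in> pverts X \<rightarrow> {1..k} \<and>
     (\<forall>u \<in> pverts X. \<forall>v \<in> pverts X. u \<noteq> v \<and> c u = c v \<longrightarrow> graph_dist X u v > ereal (real (c u)))"

definition packing_chromatic_number :: "'a pair_pre_digraph \<Rightarrow> nat" where
  "packing_chromatic_number X = (LEAST k. \<exists>c. packing_coloring X k c)"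

text \<open>
  The functions from \<open>V(G)\<close> to \<open>V(H)\<close> are the extensional ones, so that for finite graphs
  \<^const>\<open>Min\<close> and \<^const>\<open>Max\<close> are taken over a finite set.
\<close>

definition sierpinski_packing_chromatic_number ::
  "'a pair_pre_digraph \<Rightarrow> 'b pair_pre_digraph \<Rightarrow> nat" where
  "sierpinski_packing_chromatic_number G H =
     Min ((\<lambda>f. packing_chromatic_number (sierpinski_product G f H)) ` (pverts G \<rightarrow>\<^sub>E pverts H))"

definition upper_sierpinski_packing_chromatic_number ::
  "'a pair_pre_digraph \<Rightarrow> 'b pair_pre_digraph \<Rightarrow> nat" where
  "upper_sierpinski_packing_chromatic_number G H =
     Max ((\<lambda>f. packing_chromatic_number (sierpinski_product G f H)) ` (pverts G \<rightarrow>\<^sub>E pverts H))"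

end

theory Submission
  imports Defs
begin

text \<open>
  Let \<open>a\<close>, \<open>b\<close> be the centres of the two stars. In a colouring with the colours 1 and 2 every centre
  of a copy of \<open>H\<close> has colour 2 and every leaf colour 1, and then no connecting edge can be coloured;
  mapping \<open>a\<close> to a leaf and the leaves of \<open>G\<close> to \<open>b\<close> makes 3 colours sufficient.
  For the constant map \<open>f = b\<close>, neighbours of a vertex of colour 1 have distinct colours; hence either the
  \<open>n + 1\<close> neighbours of an outer centre (or the neighbours of the root), or the root and the \<open>m\<close> outer
  centres have distinct colours greater than 1.
  For the upper bound, if \<open>f a = b\<close>, colour all leaves 1 and all centres differently. Otherwise the
  outer centres take colour 3, their leaves colour 1, and in the inner star either the centre
  (if no outer star hangs on it) or the leaves without an outer star take colour 1; all other
  vertices get colours of their own.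
\<close>

section \<open>Distances and powers of the arc relation\<close>

text \<open>Powers of the arc relation unfold easily into single arcs. \<open>u\<close> has to be a
  vertex because even the empty walk requires it.\<close>

lemma (in pair_wf_digraph) relpow_iff_awalk:
  assumes "u \<in> pverts G"
  shows "(u, v) \<in> parcs G ^^ j \<longleftrightarrow> (\<exists>p. awalk u p v \<and> length p = j)"
  using assms
proof (induction j arbitrary: u)
  case 0
  then show ?case by (auto simp: awalk_Nil_iff)
next
  case (Suc j)
  show ?case
  proof
    assume "(u, v) \<in> parcs G ^^ Suc j"
    then obtain w where w: "(u, w) \<in> parcs G" "(w, v) \<in> parcs G ^^ j"
      by (metis relpow_Suc_D2)
    with Suc.IH[of w] obtain p where "awalk w p v" "length p = j"
      using in_arcsD2 by blast
    with w show "\<exists>p. awalk u p v \<and> length p = Suc j"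
      by (intro exI[of _ "(u, w) # p"]) (auto simp: awalk_Cons_iff)
  next
    assume "\<exists>p. awalk u p v \<and> length p = Suc j"
    then obtain e p where "awalk u (e # p) v" "length p = j"
      by (metis length_Suc_conv)
    then have "(u, snd e) \<in> parcs G" "(snd e, v) \<in> parcs G ^^ j"
      using Suc.IH[of "snd e"] arc_snd_in_verts by (auto simp: awalk_Cons_iff)
    then show "(u, v) \<in> parcs G ^^ Suc j"
      by (metis relpow_Suc_I2)
  qed
qed

text \<open>With unit weights the cost of a walk is its length, so the distance is an infimum of
  lengths.\<close>

lemma graph_dist_le_iff:
  assumes "pair_graph X" "u \<in> pverts X"
  shows "graph_dist X u v \<le> ereal (real l) \<longleftrightarrow> (\<exists>j\<le>l. (u, v) \<in> parcs X ^^ j)"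
proof -
  interpret pair_graph X by fact
  have cost: "awalk_cost (\<lambda>_. 1) p = real (length p)" for p
    by (induction p) auto
  have dist: "graph_dist X u v = (INF p\<in>{p. awalk u p v}. ereal (real (length p)))"
    unfolding graph_dist_def \<mu>_def cost ..
  have "graph_dist X u v \<le> ereal (real l) \<longleftrightarrow> (\<exists>p. awalk u p v \<and> length p \<le> l)"
  proof
    assume "graph_dist X u v \<le> ereal (real l)"
    \<comment> \<open>The strict bound lets \<open>INF_less_iff\<close> supply an actual
      walk.\<close>
    also have "\<dots> < ereal (real (Suc l))" by simp
    finally show "\<exists>p. awalk u p v \<and> length p \<le> l"
      unfolding dist by (auto simp: INF_less_iff less_Suc_eq_le)
  next
    assume "\<exists>p. awalk u p v \<and> length p \<le> l"
    then show "graph_dist X u v \<le> ereal (real l)"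
      unfolding dist by (auto intro: INF_lower2)
  qed
  then show ?thesis
    using relpow_iff_awalk[OF assms(2)] by auto
qed

section \<open>Local constraints and a criterion for packing colourings\<close>

lemma packing_coloring_range:
  "packing_coloring X k c \<Longrightarrow> x \<in> pverts X \<Longrightarrow> 1 \<le> c x \<and> c x \<le> k"
  unfolding packing_coloring_def by (auto simp: Pi_iff)

lemma packing_coloring_relpow:
  assumes "pair_graph X" "packing_coloring X k c" "u \<in> pverts X" "v \<in> pverts X" "u \<noteq> v"
    and "(u, v) \<in> parcs X ^^ j" "j \<le> c u"
  shows "c u \<noteq> c v"
proof
  assume "c u = c v"
  with assms(2-5) have "\<not> graph_dist X u v \<le> ereal (real (c u))"
    by (auto simp: packing_coloring_def not_le)
  then have "(u, v) \<notin> parcs X ^^ j"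
    unfolding graph_dist_le_iff[OF assms(1,3)] using assms(7) by blast
  with assms(6) show False by contradiction
qed

lemma packing_coloring_arc:
  assumes "pair_graph X" "packing_coloring X k c" "(u, v) \<in> parcs X"
  shows "c u \<noteq> c v"
proof -
  from assms(1,3) have uv: "u \<in> pverts X" "v \<in> pverts X" "u \<noteq> v"
    by (auto simp: pair_graph_iff)
  show ?thesis
    using packing_coloring_relpow[OF assms(1,2) uv, of 1] packing_coloring_range[OF assms(2) uv(1)]
      assms(3) by simp
qed

text \<open>A colour other than 1 is at least 2, so it cannot recur at distance two.\<close>

lemma packing_coloring_arc_arc:
  assumes "pair_graph X" "packing_coloring X k c" "(u, w) \<in> parcs X" "(w, v) \<in> parcs X"
    and "u \<noteq> v" "c u \<noteq> 1"
  shows "c u \<noteq> c v"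
proof -
  from assms(1,3,4) have uv: "u \<in> pverts X" "v \<in> pverts X"
    by (auto simp: pair_graph_iff)
  have "(u, v) \<in> parcs X ^^ 2"
    using assms(3,4) by (auto simp: numeral_2_eq_2)
  moreover have "2 \<le> c u"
    using packing_coloring_range[OF assms(2) uv(1)] assms(6) by simp
  ultimately show ?thesis
    using packing_coloring_relpow[OF assms(1,2) uv assms(5)] by blast
qed

text \<open>Any two vertices of \<open>K\<close> are joined by a walk of length two through
  \<open>w\<close>.\<close>

lemma packing_coloring_inj_on_neighbours:
  assumes "pair_graph X" "packing_coloring X k c"
    and "\<And>x. x \<in> K \<Longrightarrow> (x, w) \<in> parcs X" "\<And>x. x \<in> K \<Longrightarrow> c x \<noteq> 1"
  shows "inj_on c K"
proof (rule inj_onI, rule ccontr)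
  fix x y assume xy: "x \<in> K" "y \<in> K" "c x = c y" "x \<noteq> y"
  have "(w, y) \<in> parcs X"
    using assms(1) assms(3)[OF xy(2)] by (auto simp: pair_graph_iff dest: symD)
  from packing_coloring_arc_arc[OF assms(1,2) assms(3)[OF xy(1)] this xy(4) assms(4)[OF xy(1)]] xy(3)
  show False by contradiction
qed

text \<open>In the colourings constructed below only 1 and 3 may repeat. Colour 1 needs an
  independent set, colour 3 the absence of walks of length at most 3.\<close>

lemma packing_coloringI:
  assumes X: "pair_graph X"
    and range: "\<And>x. x \<in> pverts X \<Longrightarrow> 1 \<le> c x \<and> c x \<le> k"
    and one: "\<And>x y. (x, y) \<in> parcs X \<Longrightarrow> c x = 1 \<Longrightarrow> c y \<noteq> 1"
    and same: "\<And>x y. x \<in> pverts X \<Longrightarrow> y \<in> pverts X \<Longrightarrow> x \<noteq> y \<Longrightarrow> c x = c y \<Longrightarrow> c x \<noteq> 1 \<Longrightarrow>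
      c x = 3 \<and> (\<forall>j\<le>3. (x, y) \<notin> parcs X ^^ j)"
  shows "packing_coloring X k c"
  unfolding packing_coloring_def
proof (intro conjI ballI impI)
  show "c \<in> pverts X \<rightarrow> {1..k}" using range by auto
next
  fix u v assume uv: "u \<in> pverts X" "v \<in> pverts X" "u \<noteq> v \<and> c u = c v"
  have "\<forall>j\<le>c u. (u, v) \<notin> parcs X ^^ j"
  proof (cases "c u = 1")
    case True
    with uv one[of u v] have "(u, v) \<notin> parcs X" by auto
    moreover have "j = 0 \<or> j = 1" if "j \<le> c u" for j
      using True that by linarith
    ultimately show ?thesis using uv(3) by fastforce
  next
    case False
    with same[of u v] uv show ?thesis by auto
  qed
  then have "\<not> graph_dist X u v \<le> ereal (real (c u))"
    using graph_dist_le_iff[OF X uv(1)] by blast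
  then show "ereal (real (c u)) < graph_dist X u v" by simp
qed

section \<open>The packing chromatic number\<close>

lemma packing_chromatic_number_le:
  "packing_coloring X k c \<Longrightarrow> packing_chromatic_number X \<le> k"
  unfolding packing_chromatic_number_def by (rule Least_le) blast

text \<open>The colouring \<open>c\<close> ensures that the \<open>LEAST\<close> value is attained
  by some colouring, to which the second assumption applies.\<close>

lemma packing_chromatic_number_ge:
  assumes "packing_coloring X k c" "\<And>k c. packing_coloring X k c \<Longrightarrow> l \<le> k"
  shows "l \<le> packing_chromatic_number X"
proof -
  have "\<exists>c. packing_coloring X (packing_chromatic_number X) c"
    unfolding packing_chromatic_number_def by (rule LeastI[of _ k]) (use assms(1) in blast)
  with assms(2) show ?thesis by blast
qed

lemma packing_coloring_card_le:
  assumes "packing_coloring X k c" "K \<subseteq> pverts X" "inj_on c K" "\<And>x. x \<in> K \<Longrightarrow> c x \<noteq> 1" "K \<noteq> {}"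
  shows "card K + 1 \<le> k"
proof -
  have sub: "c ` K \<subseteq> {2..k}"
  proof
    fix i assume "i \<in> c ` K"
    then obtain x where "x \<in> K" "i = c x" by blast
    with assms(2,4) packing_coloring_range[OF assms(1), of x] show "i \<in> {2..k}" by force
  qed
  \<comment> \<open>This keeps the subtraction in \<open>card {2..k} = k - 1\<close> from being
    truncated.\<close>
  with assms(5) have "2 \<le> k" by fastforce
  with card_inj_on_le[OF assms(3) sub] show ?thesis by simp
qed

section \<open>The Sierpinski product of two stars\<close>

locale two_stars =
  fixes G :: "'a pair_pre_digraph" and H :: "'b pair_pre_digraph"
    and a :: 'a and A :: "'a set" and b :: 'b and B :: "'b set"
  assumes G: "pverts G = insert a A" "parcs G = {a} \<times> A \<union> A \<times> {a}" "a \<notin> A" "finite A"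
    and H: "pverts H = insert b B" "parcs H = {b} \<times> B \<union> B \<times> {b}" "b \<notin> B" "finite B"
begin

lemma pair_graph_factors: "pair_graph G" "pair_graph H"
  using G H by (auto simp: pair_graph_iff sym_def)

abbreviation "P f \<equiv> sierpinski_product G f H"

lemma pverts_P: "pverts (P f) = insert a A \<times> insert b B"
  by (simp add: sierpinski_product_def G H)

text \<open>Every arc of \<open>G\<close> contains \<open>a\<close>, so each leaf \<open>g\<close>
  contributes one connecting edge, between \<open>(a, f g)\<close> and
  \<open>(g, f a)\<close>.\<close>

lemma parcs_P: "((g, h), (g', h')) \<in> parcs (P f) \<longleftrightarrow>
   g = g' \<and> g \<in> insert a A \<and> (h = b \<and> h' \<in> B \<or> h \<in> B \<and> h' = b) \<or>
   g = a \<and> g' \<in> A \<and> h = f g' \<and> h' = f a \<or>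
   g \<in> A \<and> g' = a \<and> h = f a \<and> h' = f g"
  by (auto simp: sierpinski_product_def G H)

lemma pair_graph_P: "f \<in> insert a A \<rightarrow> insert b B \<Longrightarrow> pair_graph (P f)"
  by (rule pair_graph_sierpinski_product) (use pair_graph_factors G(1) H(1) in auto)

section \<open>Colourings for the upper bounds\<close>

text \<open>As \<open>f a = b\<close>, every connecting edge ends at an outer centre, so the leaves
  of the copies are adjacent to centres only and can all take colour 1.\<close>

lemma ex_coloring_centre:
  assumes f: "f \<in> insert a A \<rightarrow> insert b B" and fa: "f a = b"
  shows "\<exists>c. packing_coloring (P f) (card A + 2) c"
proof -
  \<comment> \<open>Colour 2 is kept for the inner centre.\<close>
  obtain e where e: "e ` A \<subseteq> {3..card A + 2}" "inj_on e A"
    using card_le_inj[OF G(4), of "{3..card A + 2}"] by auto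
  define c where "c = (\<lambda>(g, h). if h \<noteq> b then 1 else if g = a then 2 else e g)"
  have e3: "3 \<le> e g" "e g \<le> card A + 2" if "g \<in> A" for g
    using e(1) that by auto
  have "packing_coloring (P f) (card A + 2) c"
  proof (rule packing_coloringI[OF pair_graph_P[OF f]])
    fix x assume "x \<in> pverts (P f)"
    then show "1 \<le> c x \<and> c x \<le> card A + 2"
      using e3[of "fst x"] by (cases x) (auto simp: c_def pverts_P)
  next
    fix x y assume "(x, y) \<in> parcs (P f)" "c x = 1"
    then show "c y \<noteq> 1"
      using e3(1)[of "fst y"] e3(1)[of "fst x"] H(3) fa
      by (cases x; cases y) (auto simp: parcs_P c_def split: if_splits)
  next
    fix x y assume "x \<in> pverts (P f)" "y \<in> pverts (P f)" "x \<noteq> y" "c x = c y" "c x \<noteq> 1"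
    then have False
      using e3(1)[of "fst x"] e3(1)[of "fst y"] inj_onD[OF e(2), of "fst x" "fst y"]
      by (cases x; cases y) (auto simp: pverts_P c_def split: if_splits)
    then show "c x = 3 \<and> (\<forall>j\<le>3. (x, y) \<notin> parcs (P f) ^^ j)" ..
  qed
  then show ?thesis by blast
qed

text \<open>
  If the outer stars hang on leaves, their centres are at pairwise distance at least 4 and may all
  be coloured 3; only the colouring \<open>d\<close> of the inner star remains to be chosen.
\<close>

lemma coloring_leaf:
  assumes f: "f \<in> insert a A \<rightarrow> insert b B" and fa: "f a \<noteq> b" and k: "3 \<le> k"
    and d: "\<And>h. h \<in> insert b B \<Longrightarrow> 1 \<le> d h \<and> d h \<le> k \<and> d h \<noteq> 3"
    and inj: "\<And>h h'. h \<in> insert b B \<Longrightarrow> h' \<in> insert b B \<Longrightarrow> h \<noteq> h' \<Longrightarrow> d h = d h' \<Longrightarrow> d h = 1"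
    and d_f: "\<And>g. g \<in> A \<Longrightarrow> d (f g) \<noteq> 1"
    and d_b: "d b \<noteq> 1 \<or> (\<forall>h\<in>B. d h \<noteq> 1)"
  shows "packing_coloring (P f) k (\<lambda>(g, h). if g = a then d h else if h = b then 3 else 1)"
    (is "packing_coloring _ _ ?c")
proof (rule packing_coloringI[OF pair_graph_P[OF f]])
  fix x assume "x \<in> pverts (P f)"
  then show "1 \<le> ?c x \<and> ?c x \<le> k"
    using d k by (cases x) (auto simp: pverts_P)
next
  fix x y assume xy: "(x, y) \<in> parcs (P f)" "?c x = 1"
  obtain g h g' h' where gh: "x = (g, h)" "y = (g', h')" by fastforce
  from xy(1)[unfolded gh parcs_P] consider "g = g'" "h = b" "h' \<in> B" | "g = g'" "h \<in> B" "h' = b"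
    | "g = a" "g' \<in> A" "h = f g'" | "g \<in> A" "g' = a" "h' = f g"
    by blast
  then show "?c y \<noteq> 1"
  proof cases
    case 1
    then show ?thesis using xy(2) d_b by (auto simp: gh split: if_splits)
  next
    case 2
    then show ?thesis using xy(2) d_b by (auto simp: gh split: if_splits)
  next
    case 3
    then show ?thesis using xy(2) d_f[of g'] by (simp add: gh)
  next
    case 4
    then show ?thesis using d_f[of g] by (simp add: gh)
  qed
next
  fix x y assume xy: "x \<in> pverts (P f)" "y \<in> pverts (P f)" "x \<noteq> y" "?c x = ?c y" "?c x \<noteq> 1"
  \<comment> \<open>Off the colour 1, \<open>d\<close> is injective and avoids 3, so a repeated
    colour is the 3 of two outer centres.\<close>
  obtain g g' where gg: "x = (g, b)" "y = (g', b)" "g \<in> A" "g' \<in> A" "g \<noteq> g'"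
    using xy inj[of "snd x" "snd y"] d[of "snd x"] d[of "snd y"]
    by (cases x; cases y) (auto simp: pverts_P split: if_splits)
  \<comment> \<open>Since \<open>f a \<noteq> b\<close>, the connecting edge of an outer star is
    attached at a leaf, and its centre sees only its own leaves.\<close>
  have out: "\<exists>h\<in>B. y = (g, h)" if "((g, b), y) \<in> parcs (P f)" "g \<in> A" for g y
    using that fa G(3) H(3) by (cases y) (auto simp: parcs_P)
  have inn: "\<exists>h\<in>B. y = (g, h)" if "(y, (g, b)) \<in> parcs (P f)" "g \<in> A" for g y
    using that fa G(3) H(3) by (cases y) (auto simp: parcs_P)
  have "(x, y) \<notin> parcs (P f) ^^ j" if "j \<le> 3" for j
  proof
    assume j: "(x, y) \<in> parcs (P f) ^^ j"
    from that consider "j = 0" | "j = 1" | "j = 2" | "j = 3" by linarith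
    then show False
    proof cases
      case 1
      with j gg show False by simp
    next
      case 2
      with j gg out[of g y] show False by auto
    next
      case 3
      with j obtain z where "(x, z) \<in> parcs (P f)" "(z, y) \<in> parcs (P f)"
        by (auto simp: numeral_2_eq_2)
      with gg out[of g z] inn[of z g'] show False by auto
    next
      case 4
      with j obtain z w where "(x, z) \<in> parcs (P f)" "(z, w) \<in> parcs (P f)" "(w, y) \<in> parcs (P f)"
        by (auto simp: numeral_3_eq_3)
      \<comment> \<open>A walk of length 3 would need an arc between two different outer stars, but
        every connecting edge meets the inner star.\<close>
      with gg out[of g z] inn[of w g'] obtain h h'
        where "((g, h), (g', h')) \<in> parcs (P f)" by auto
      with gg G(3) show False by (auto simp: parcs_P)
    qed
  qed
  with gg G(3) show "?c x = 3 \<and> (\<forall>j\<le>3. (x, y) \<notin> parcs (P f) ^^ j)"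
    by auto
qed

text \<open>An inner vertex with an outer star hanging on it is adjacent to a leaf coloured 1 and
  must avoid that colour. Whether the centre \<open>b\<close> is such a vertex decides which inner
  vertices take colour 1.\<close>

lemma ex_coloring_leaf:
  assumes f: "f \<in> insert a A \<rightarrow> insert b B" and fa: "f a \<noteq> b" and A: "A \<noteq> {}"
  shows "\<exists>c. packing_coloring (P f) (max (card A + 2) (card B + 2)) c"
proof (cases "b \<in> f ` A")
  case True
  let ?L = "f ` A - {b}"
  \<comment> \<open>One value of \<open>f\<close> on \<open>A\<close> is \<open>b\<close>, so at
    most \<open>card A - 1\<close> leaves carry an outer star. Colours from 4 on serve them, 2 and 3
    going to the inner and the outer centres.\<close>
  have "card ?L = card (f ` A) - 1"
    using True by (simp add: G)
  also have "\<dots> \<le> card A - 1"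
    using card_image_le[OF G(4), of f] by linarith
  also have "\<dots> = card {4..card A + 2}" by simp
  finally obtain e where e: "e ` ?L \<subseteq> {4..card A + 2}" "inj_on e ?L"
    using card_le_inj[of ?L "{4..card A + 2}"] G(4) by auto
  define d where "d h = (if h = b then 2 else if h \<in> f ` A then e h else 1)" for h
  have e4: "4 \<le> e h" "e h \<le> card A + 2" if "h \<in> f ` A" "h \<noteq> b" for h
    using subsetD[OF e(1) imageI, of h] that by auto
  have "card A > 0" using A G(4) by (simp add: card_gt_0_iff)
  have "packing_coloring (P f) (max (card A + 2) (card B + 2))
          (\<lambda>(g, h). if g = a then d h else if h = b then 3 else 1)"
  proof (rule coloring_leaf[OF f fa])
    show "3 \<le> max (card A + 2) (card B + 2)" using \<open>card A > 0\<close> by simp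
  next
    fix h assume "h \<in> insert b B"
    then show "1 \<le> d h \<and> d h \<le> max (card A + 2) (card B + 2) \<and> d h \<noteq> 3"
      using e4[of h] by (auto simp: d_def)
  next
    fix h h' assume "h \<noteq> h'" "d h = d h'"
    then show "d h = 1"
      using e4[of h] e4[of h'] inj_onD[OF e(2), of h h'] by (auto simp: d_def split: if_splits)
  next
    fix g assume "g \<in> A"
    then show "d (f g) \<noteq> 1" using e4[of "f g"] by (auto simp: d_def)
  next
    show "d b \<noteq> 1 \<or> (\<forall>h\<in>B. d h \<noteq> 1)" by (simp add: d_def)
  qed
  then show ?thesis by blast
next
  case False
  have "B \<noteq> {}" using f fa by auto
  then have "card B > 0" using H(4) by (simp add: card_gt_0_iff)
  \<comment> \<open>As \<open>card B > 0\<close>, colour 3 is one of the \<open>card B + 1\<close>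
    elements of \<open>{2..card B + 2}\<close>, so \<open>card B\<close> colours remain.\<close>
  have "card B \<le> card ({2..card B + 2} - {3})"
    using \<open>card B > 0\<close> by (subst card_Diff_singleton) auto
  then obtain e where e: "e ` B \<subseteq> {2..card B + 2} - {3}" "inj_on e B"
    using card_le_inj[of B "{2..card B + 2} - {3}"] H(4) by auto
  define d where "d h = (if h = b then 1 else e h)" for h
  have e2: "2 \<le> e h" "e h \<le> card B + 2" "e h \<noteq> 3" if "h \<in> B" for h
    using e(1) that by auto
  have "packing_coloring (P f) (max (card A + 2) (card B + 2))
          (\<lambda>(g, h). if g = a then d h else if h = b then 3 else 1)"
  proof (rule coloring_leaf[OF f fa])
    show "3 \<le> max (card A + 2) (card B + 2)" using \<open>card B > 0\<close> by simp
  next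
    fix h assume "h \<in> insert b B"
    then show "1 \<le> d h \<and> d h \<le> max (card A + 2) (card B + 2) \<and> d h \<noteq> 3"
      using e2[of h] by (auto simp: d_def)
  next
    fix h h' assume "h \<in> insert b B" "h' \<in> insert b B" "h \<noteq> h'" "d h = d h'"
    then show "d h = 1"
      using e2[of h] e2[of h'] inj_onD[OF e(2), of h h'] by (auto simp: d_def split: if_splits)
  next
    fix g assume "g \<in> A"
    then have "f g \<in> insert b B" "f g \<noteq> b" using f False by auto
    then show "d (f g) \<noteq> 1" using e2[of "f g"] by (auto simp: d_def)
  next
    have "d h \<noteq> 1" if "h \<in> B" for h
      using e2[OF that] H(3) that by (auto simp: d_def)
    then show "d b \<noteq> 1 \<or> (\<forall>h\<in>B. d h \<noteq> 1)" by blast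
  qed
  then show ?thesis by blast
qed

lemma ex_coloring:
  assumes f: "f \<in> insert a A \<rightarrow> insert b B" and A: "A \<noteq> {}"
  shows "\<exists>k c. k \<le> max (card A + 2) (card B + 2) \<and> packing_coloring (P f) k c"
proof (cases "f a = b")
  case True
  then show ?thesis using ex_coloring_centre[OF f] by (meson max.cobounded1)
next
  case False
  then show ?thesis using ex_coloring_leaf[OF f _ A] by blast
qed

text \<open>All outer stars hang on the inner centre, so the inner star needs only 1 and 2. The
  restriction makes the map extensional, as the minimum demands.\<close>

lemma ex_3_coloring:
  assumes "h \<in> B"
  shows "packing_coloring (P (\<lambda>g\<in>insert a A. if g = a then h else b)) 3
    (\<lambda>(g, h). if g = a then if h = b then 2 else 1 else if h = b then 3 else 1)"
proof (rule coloring_leaf)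
  show "(\<lambda>g\<in>insert a A. if g = a then h else b) \<in> insert a A \<rightarrow> insert b B"
    using assms by auto
  show "(\<lambda>g\<in>insert a A. if g = a then h else b) a \<noteq> b"
    using assms H(3) by auto
  show "(if (\<lambda>g\<in>insert a A. if g = a then h else b) g = b then 2 else 1) \<noteq> (1 :: nat)" if "g \<in> A" for g
    using that G(3) by auto
qed (auto split: if_splits)

section \<open>Lower bounds for colourings\<close>

text \<open>Two colours force 2 on centres and 1 on leaves. A connecting edge then joins equal
  colours or puts two centres at distance two.\<close>

lemma coloring_ge_3:
  assumes f: "f \<in> insert a A \<rightarrow> insert b B" and A: "A \<noteq> {}" and B: "2 \<le> card B"
    and c: "packing_coloring (P f) k c"
  shows "3 \<le> k"
proof (rule ccontr)
  assume "\<not> 3 \<le> k"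
  note X = pair_graph_P[OF f]
  have range: "c x = 1 \<or> c x = 2" if "x \<in> pverts (P f)" for x
    using packing_coloring_range[OF c that] \<open>\<not> 3 \<le> k\<close> by linarith
  note arc = packing_coloring_arc[OF X c]
  have centre: "c (g, b) = 2" if g: "g \<in> insert a A" for g
  proof (rule ccontr)
    assume "c (g, b) \<noteq> 2"
    \<comment> \<open>A centre coloured 1 would have two leaves coloured 2 at distance two from each
      other.\<close>
    obtain h h' where h: "h \<in> B" "h' \<in> B" "h \<noteq> h'"
      using B card_le_Suc0_iff_eq[OF H(4)] by force
    with g have "((g, h), (g, b)) \<in> parcs (P f)" "((g, b), (g, h')) \<in> parcs (P f)"
      by (auto simp: parcs_P)
    moreover from arc[OF this(1)] arc[OF this(2)] have "c (g, h) = 2" "c (g, h') = 2"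
      using range[of "(g, b)"] range[of "(g, h)"] range[of "(g, h')"] \<open>c (g, b) \<noteq> 2\<close> g h
      by (auto simp: pverts_P)
    ultimately show False
      using packing_coloring_arc_arc[OF X c, of "(g, h)" "(g, b)" "(g, h')"] h by auto
  qed
  have leaf: "c (g, h) = 1" if "g \<in> insert a A" "h \<in> B" for g h
  proof -
    have "((g, b), (g, h)) \<in> parcs (P f)" using that by (auto simp: parcs_P)
    from arc[OF this] centre range[of "(g, h)"] that show ?thesis by (auto simp: pverts_P)
  qed
  obtain g where g: "g \<in> A" using A by blast
  with G(3) have "g \<noteq> a" by blast
  have e: "((a, f g), (g, f a)) \<in> parcs (P f)" using g by (simp add: parcs_P)
  have "f a \<in> insert b B" "f g \<in> insert b B" using f g by auto
  then consider "f a = b" "f g = b" | "f a \<in> B" "f g \<in> B" | "f a \<in> B" "f g = b" | "f a = b" "f g \<in> B"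
    by auto
  then show False
  proof cases
    case 1
    then show False using arc[OF e] centre g by simp
  next
    case 2
    then show False using arc[OF e] leaf g by simp
  next
    case 3
    then have "((g, f a), (g, b)) \<in> parcs (P f)" using g by (auto simp: parcs_P)
    from packing_coloring_arc_arc[OF X c e this] 3 centre g \<open>g \<noteq> a\<close> show False by simp
  next
    case 4
    then have "((a, b), (a, f g)) \<in> parcs (P f)" using g by (auto simp: parcs_P)
    from packing_coloring_arc_arc[OF X c this e] 4 centre g \<open>g \<noteq> a\<close> show False by simp
  qed
qed

text \<open>The centres of the copies form a star with root \<open>(a, b)\<close>. The cases ask
  which centre, if any, is coloured 1; each then counts colours other than 1.\<close>

lemma coloring_const_centre_ge:
  assumes f: "\<And>g. g \<in> insert a A \<Longrightarrow> f g = b" and A: "A \<noteq> {}"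
    and c: "packing_coloring (P f) k c"
  shows "min (card A + 2) (card B + 2) \<le> k"
proof -
  have "f \<in> insert a A \<rightarrow> insert b B" using f by auto
  note X = pair_graph_P[OF this]
  note arc = packing_coloring_arc[OF X c]
  have root_child: "((a, b), (g, b)) \<in> parcs (P f)" "((g, b), (a, b)) \<in> parcs (P f)" if "g \<in> A" for g
    using that f by (auto simp: parcs_P)
  have star: "((g, b), (g, h)) \<in> parcs (P f)" "((g, h), (g, b)) \<in> parcs (P f)"
    if "h \<in> B" "g \<in> insert a A" for g h
    using that by (auto simp: parcs_P)
  have card_A: "card ((\<lambda>g. (g, b)) ` A) = card A" for b :: 'b
    by (rule card_image) (auto simp: inj_on_def)
  have card_B: "card (Pair g ` B) = card B" for g :: 'a
    by (rule card_image) (auto simp: inj_on_def)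
  consider "c (a, b) = 1" | g where "g \<in> A" "c (g, b) = 1"
    | "c (a, b) \<noteq> 1" "\<And>g. g \<in> A \<Longrightarrow> c (g, b) \<noteq> 1"
    by blast
  then show ?thesis
  proof cases
    case 1
    obtain g where g: "g \<in> A" using A by blast
    \<comment> \<open>The inner leaves and a single outer centre already give
      \<open>card B + 1\<close> neighbours of the root.\<close>
    let ?K = "insert (g, b) (Pair a ` B)"
    have nbr: "(x, (a, b)) \<in> parcs (P f)" if "x \<in> ?K" for x
      using that root_child g star by auto
    have "card ?K + 1 \<le> k"
    proof (rule packing_coloring_card_le[OF c])
      show ne: "c x \<noteq> 1" if "x \<in> ?K" for x
        using arc[OF nbr[OF that]] 1 by simp
      show "inj_on c ?K"
        by (rule packing_coloring_inj_on_neighbours[OF X c nbr ne])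
      show "?K \<subseteq> pverts (P f)" using g by (auto simp: pverts_P)
    qed simp
    moreover have "card ?K = card B + 1"
      using H(3,4) G(3) g by (subst card_insert_disjoint) (auto simp: card_B)
    ultimately show ?thesis by simp
  next
    case (2 g)
    let ?K = "insert (a, b) (Pair g ` B)"
    have nbr: "(x, (g, b)) \<in> parcs (P f)" if "x \<in> ?K" for x
      using that root_child 2 star by auto
    have "card ?K + 1 \<le> k"
    proof (rule packing_coloring_card_le[OF c])
      show ne: "c x \<noteq> 1" if "x \<in> ?K" for x
        using arc[OF nbr[OF that]] 2 by simp
      show "inj_on c ?K"
        by (rule packing_coloring_inj_on_neighbours[OF X c nbr ne])
      show "?K \<subseteq> pverts (P f)" using 2 by (auto simp: pverts_P)
    qed simp
    moreover have "card ?K = card B + 1"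
      using H(3,4) by (subst card_insert_disjoint) (auto simp: card_B)
    ultimately show ?thesis by simp
  next
    case 3
    let ?C = "(\<lambda>g. (g, b)) ` A"
    have "card (insert (a, b) ?C) + 1 \<le> k"
    proof (rule packing_coloring_card_le[OF c])
      have nbr: "(x, (a, b)) \<in> parcs (P f)" "c x \<noteq> 1" if "x \<in> ?C" for x
        using that root_child 3 by auto
      have "inj_on c ?C"
        by (rule packing_coloring_inj_on_neighbours[OF X c nbr])
      \<comment> \<open>The root is not its own neighbour; its colour is separated by the arcs from
        the outer centres.\<close>
      moreover have "c (a, b) \<notin> c ` ?C"
        using arc[OF nbr(1)] by fastforce
      ultimately show "inj_on c (insert (a, b) ?C)" by (auto simp: inj_on_insert)
      show "insert (a, b) ?C \<subseteq> pverts (P f)" by (auto simp: pverts_P)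
    qed (use 3 in auto)
    moreover have "card (insert (a, b) ?C) = card A + 1"
      using G(3,4) by (subst card_insert_disjoint) (auto simp: card_A)
    ultimately show ?thesis by simp
  qed
qed

section \<open>Minimum and maximum over all maps\<close>

lemma packing_chromatic_number_bounds:
  assumes f: "f \<in> insert a A \<rightarrow> insert b B" and A: "A \<noteq> {}" and B: "2 \<le> card B"
  shows "3 \<le> packing_chromatic_number (P f)"
    and "packing_chromatic_number (P f) \<le> max (card A + 2) (card B + 2)"
proof -
  obtain k c where kc: "k \<le> max (card A + 2) (card B + 2)" "packing_coloring (P f) k c"
    using ex_coloring[OF f A] by blast
  show "packing_chromatic_number (P f) \<le> max (card A + 2) (card B + 2)"
    using packing_chromatic_number_le[OF kc(2)] kc(1) by linarith
  show "3 \<le> packing_chromatic_number (P f)"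
    by (rule packing_chromatic_number_ge[OF kc(2)]) (rule coloring_ge_3[OF f A B])
qed

lemma finite_chromatic_numbers:
  "finite ((\<lambda>f. packing_chromatic_number (P f)) ` (pverts G \<rightarrow>\<^sub>E pverts H))"
  by (intro finite_imageI finite_PiE) (simp_all add: G H)

lemma sierpinski_packing_chromatic_number_stars:
  assumes A: "A \<noteq> {}" and B: "2 \<le> card B"
  shows "sierpinski_packing_chromatic_number G H = 3"
  unfolding sierpinski_packing_chromatic_number_def
proof (rule Min_eqI[OF finite_chromatic_numbers])
  fix y assume "y \<in> (\<lambda>f. packing_chromatic_number (P f)) ` (pverts G \<rightarrow>\<^sub>E pverts H)"
  then show "3 \<le> y"
    using packing_chromatic_number_bounds(1)[OF _ A B] by (auto simp: G H PiE_def)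
next
  obtain h where h: "h \<in> B" using B by fastforce
  \<comment> \<open>This map admits the 3-colouring, and the general lower bound makes its value
    exactly 3.\<close>
  let ?f = "\<lambda>g\<in>insert a A. if g = a then h else b"
  have f: "?f \<in> pverts G \<rightarrow>\<^sub>E pverts H" using h by (auto simp: G H)
  then have "packing_chromatic_number (P ?f) = 3"
    using packing_chromatic_number_le[OF ex_3_coloring[OF h]]
      packing_chromatic_number_bounds(1)[OF _ A B, of ?f] by (simp add: G H PiE_def)
  with f show "3 \<in> (\<lambda>f. packing_chromatic_number (P f)) ` (pverts G \<rightarrow>\<^sub>E pverts H)"
    by (intro image_eqI[OF _ f]) simp
qed

lemma upper_sierpinski_packing_chromatic_number_stars:
  assumes A: "A \<noteq> {}" and B: "2 \<le> card B"
  shows "min (card A + 2) (card B + 2) \<le> upper_sierpinski_packing_chromatic_number G H"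
    and "upper_sierpinski_packing_chromatic_number G H \<le> max (card A + 2) (card B + 2)"
proof -
  \<comment> \<open>The map constant at the centre bounds the maximum from below.\<close>
  let ?f = "\<lambda>g\<in>insert a A. b"
  let ?S = "(\<lambda>f. packing_chromatic_number (P f)) ` (pverts G \<rightarrow>\<^sub>E pverts H)"
  have f: "?f \<in> pverts G \<rightarrow>\<^sub>E pverts H" "?f \<in> insert a A \<rightarrow> insert b B" by (auto simp: G H)
  obtain k c where "packing_coloring (P ?f) k c"
    using ex_coloring[OF f(2) A] by blast
  then have "min (card A + 2) (card B + 2) \<le> packing_chromatic_number (P ?f)"
    by (rule packing_chromatic_number_ge) (rule coloring_const_centre_ge[OF _ A], auto)
  also have "\<dots> \<le> Max ?S"
    by (rule Max_ge[OF finite_chromatic_numbers]) (use f in blast)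
  finally show "min (card A + 2) (card B + 2) \<le> upper_sierpinski_packing_chromatic_number G H"
    unfolding upper_sierpinski_packing_chromatic_number_def .
  show "upper_sierpinski_packing_chromatic_number G H \<le> max (card A + 2) (card B + 2)"
    unfolding upper_sierpinski_packing_chromatic_number_def
  proof (rule Max.boundedI[OF finite_chromatic_numbers])
    show "?S \<noteq> {}" using f(1) by blast
  next
    fix y assume "y \<in> ?S"
    then obtain f where "f \<in> insert a A \<rightarrow> insert b B" "y = packing_chromatic_number (P f)"
      by (auto simp: G H PiE_def)
    then show "y \<le> max (card A + 2) (card B + 2)"
      using packing_chromatic_number_bounds(2)[OF _ A B] by blast
  qed
qed

end

section \<open>Stars as complete bipartite graphs\<close>

text \<open>The one-element side of the bipartition is the centre, the other side the set of
  leaves.\<close>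

lemma star_decomposition:
  assumes "complete_bipartite_digraph 1 m (with_proj G)"
  obtains a A where "pverts G = insert a A" "parcs G = {a} \<times> A \<union> A \<times> {a}" "a \<notin> A"
    "finite A" "card A = m"
proof -
  from assms[unfolded complete_bipartite_digraph_pair_def] obtain U A where
    UA: "finite (pverts G)" "pverts G = U \<union> A" "U \<inter> A = {}" "card U = 1" "card A = m"
      "parcs G = U \<times> A \<union> A \<times> U"
    by blast
  from UA(4) obtain a where "U = {a}" by (auto simp: card_1_singleton_iff)
  with UA show thesis by (intro that[of a A]) auto
qed

theorem theorem4p7:
  fixes G :: "'a pair_pre_digraph" and H :: "'b pair_pre_digraph" and m n :: nat
  assumes "m \<ge> 3" and "n \<ge> 3"
    and "complete_bipartite_digraph 1 m (with_proj G)"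
    and "complete_bipartite_digraph 1 n (with_proj H)"
  shows "sierpinski_packing_chromatic_number G H = 3 \<and>
    min (m + 2) (n + 2) \<le> upper_sierpinski_packing_chromatic_number G H \<and>
    upper_sierpinski_packing_chromatic_number G H \<le> max (m + 2) (n + 2)"
proof -
  obtain a A where A: "pverts G = insert a A" "parcs G = {a} \<times> A \<union> A \<times> {a}" "a \<notin> A"
      "finite A" "card A = m"
    using star_decomposition[OF assms(3)] by blast
  obtain b B where B: "pverts H = insert b B" "parcs H = {b} \<times> B \<union> B \<times> {b}" "b \<notin> B"
      "finite B" "card B = n"
    using star_decomposition[OF assms(4)] by blast
  interpret two_stars G H a A b B
    by unfold_locales fact+
  have "A \<noteq> {}" "2 \<le> card B" using A(5) B(5) assms(1,2) by auto
  then show ?thesis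
    using sierpinski_packing_chromatic_number_stars
      upper_sierpinski_packing_chromatic_number_stars A(5) B(5) by simp
qed

end
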